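(* Let $G_i=(V_i,E_i)$, $i=1,2$, be two locally finite simple graphs. Then for any $x\in V_1$ and $y\in V_2$, $$\mathcal K_{G_1\times G_2,(x,y)}=\mathcal K_{G_1,x}*\mathcal K_{G_2,y}$$ as functions on $(0,\infty]$.
   Context: Graphs are undirected, without loops or multiple edges, and every vertex has finite degree; the vertices $x$ and $y$ considered have degree at least $1$. For $f:V\to\mathbb R$ put $\Delta f(x)=\sum_{y\sim x}(f(y)-f(x))$ (non-normalized Laplacian), and for $f,g:V\to\mathbb R$ put $2\Gamma(f,g)=\Delta(fg)-f\Delta g-g\Delta f$, $2\Gamma_2(f,g)=\Delta\Gamma(f,g)-\Gamma(f,\Delta g)-\Gamma(\Delta f,g)$, $\Gamma(f)=\Gamma(f,f)$, $\Gamma_2(f)=\Gamma_2(f,f)$. For $\mathcal N\in(0,\infty]$ (convention $1/\infty=0$), $\mathcal K_{G,x}(\mathcal N)$ is the largest $K\in\mathbb R$ such that $\Gamma_2(f)(x)\ge\frac1{\mathcal N}(\Delta f(x))^2+K\,\Gamma(f)(x)$ for all $f:V\to\mathbb R$ (Bakry-Émery curvature function). Cartesian product: $G_1\times G_2$ has vertex set $V_1\times V_2$, and $(x_1,y_1),(x_2,y_2)$ are adjacent iff either $x_1=x_2$ and $\{y_1,y_2\}\in E_2$, or $\{x_1,x_2\}\in E_1$ and $y_1=y_2$. $*$-product: let $\mathcal{FK}$ be the set of continuous, monotone non-decreasing functions $f:(0,\infty]\to\mathbb R$ with $\lim_{\mathcal N\to0}f(\mathcal N)=-\infty$ (curvature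 functions $\mathcal K_{G,x}$ belong to $\mathcal{FK}$). For $f_1,f_2\in\mathcal{FK}$ and $\mathcal N\in(0,\infty)$, define $f_1*f_2(\mathcal N):=f_1(\mathcal N_1)=f_2(\mathcal N_2)$, where $\mathcal N_1,\mathcal N_2>0$ are chosen with $\mathcal N_1+\mathcal N_2=\mathcal N$ and $f_1(\mathcal N_1)=f_2(\mathcal N_2)$ (such a pair exists and the value does not depend on the choice), and $f_1*f_2(\infty):=\lim_{\mathcal N\to\infty}f_1*f_2(\mathcal N)$ (the limit exists). *)

theory Defs
  imports "HOL-Analysis.Analysis"
begin

section \<open>Locally finite simple graphs\<close>

type_synonym 'a graph = "'a set \<times> 'a set set"

abbreviation verts :: "'a graph \<Rightarrow> 'a set" where "verts \<equiv> fst"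
abbreviation edges :: "'a graph \<Rightarrow> 'a set set" where "edges \<equiv> snd"

definition simple_graph :: "'a graph \<Rightarrow> bool" where
  "simple_graph G \<longleftrightarrow> (\<forall>e\<in>edges G. \<exists>u\<in>verts G. \<exists>v\<in>verts G. u \<noteq> v \<and> e = {u, v})"

definition nbrs :: "'a graph \<Rightarrow> 'a \<Rightarrow> 'a set" where
  "nbrs G x = {y. {x, y} \<in> edges G}"

definition locally_finite :: "'a graph \<Rightarrow> bool" where
  "locally_finite G \<longleftrightarrow> (\<forall>x\<in>verts G. finite (nbrs G x))"

definition cart_prod :: "'a graph \<Rightarrow> 'b graph \<Rightarrow> ('a \<times> 'b) graph" where
  "cart_prod G1 G2 =
     (verts G1 \<times> verts G2,
      {{(x1, y1), (x2, y2)} | x1 y1 x2 y2.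
         x1 \<in> verts G1 \<and> x2 \<in> verts G1 \<and> y1 \<in> verts G2 \<and> y2 \<in> verts G2 \<and>
         (x1 = x2 \<and> {y1, y2} \<in> edges G2 \<or> {x1, x2} \<in> edges G1 \<and> y1 = y2)})"


section \<open>Bakry--Emery curvature functions\<close>

text \<open>
  Functions on the vertex set are represented by total functions. In a simple graph all neighbours
  are vertices, so at a vertex none of the operators below depends on values outside
  \<^term>\<open>verts G\<close>.
\<close>

definition laplacian :: "'a graph \<Rightarrow> ('a \<Rightarrow> real) \<Rightarrow> 'a \<Rightarrow> real" where
  "laplacian G f x = (\<Sum>y\<in>nbrs G x. f y - f x)"

definition Gam :: "'a graph \<Rightarrow> ('a \<Rightarrow> real) \<Rightarrow> ('a \<Rightarrow> real) \<Rightarrow> 'a \<Rightarrow> real" where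
  "Gam G f g x =
     (laplacian G (\<lambda>z. f z * g z) x - f x * laplacian G g x - g x * laplacian G f x) / 2"

definition Gam2 :: "'a graph \<Rightarrow> ('a \<Rightarrow> real) \<Rightarrow> ('a \<Rightarrow> real) \<Rightarrow> 'a \<Rightarrow> real" where
  "Gam2 G f g x =
     (laplacian G (Gam G f g) x - Gam G f (laplacian G g) x - Gam G (laplacian G f) g x) / 2"

text \<open>
  The dimension parameter \<open>N\<close> ranges over \<open>(0,\<infinity>]\<close>, i.e. over the positive extended reals, where
  \<open>1 / \<infinity> = 0\<close>. \<^const>\<open>Greatest\<close> is a definite description of the maximum, which exists whenever
  \<open>x\<close> has positive degree.
\<close>

definition CD_ineq :: "'a graph \<Rightarrow> 'a \<Rightarrow> ereal \<Rightarrow> real \<Rightarrow> bool" where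
  "CD_ineq G x N K \<longleftrightarrow>
     (\<forall>f. Gam2 G f f x \<ge> real_of_ereal (1 / N) * (laplacian G f x)\<^sup>2 + K * Gam G f f x)"

definition curvature :: "'a graph \<Rightarrow> 'a \<Rightarrow> ereal \<Rightarrow> real" where
  "curvature G x N = (GREATEST K. CD_ineq G x N K)"


section \<open>The star product\<close>

definition FK :: "(ereal \<Rightarrow> real) set" where
  "FK = {f. continuous_on {0<..} f \<and> mono_on {0<..} f \<and> filterlim f at_bot (at_right 0)}"

definition star_prod_fin :: "(ereal \<Rightarrow> real) \<Rightarrow> (ereal \<Rightarrow> real) \<Rightarrow> ereal \<Rightarrow> real" where
  "star_prod_fin f1 f2 N =
     (THE v. \<exists>N1>0. \<exists>N2>0. N1 + N2 = N \<and> f1 N1 = v \<and> f2 N2 = v)"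

text \<open>
  The definition is meaningful for arguments in \<^const>\<open>FK\<close>: see \<open>star_prod_fin_ex1\<close>
  and \<open>star_prod_fin_convergent\<close> below.
\<close>

definition star_prod :: "(ereal \<Rightarrow> real) \<Rightarrow> (ereal \<Rightarrow> real) \<Rightarrow> ereal \<Rightarrow> real" where
  "star_prod f1 f2 N =
     (if N = \<infinity> then Lim at_top (\<lambda>t::real. star_prod_fin f1 f2 (ereal t))
      else star_prod_fin f1 f2 N)"

lemma FK_small:
  assumes "f \<in> FK" "0 < M"
  obtains a :: real where "0 < a" "a < M" "f (ereal a) \<le> c"
proof -
  have "eventually (\<lambda>x. f x \<le> c) (at_right 0)"
    using assms(1) by (auto simp: FK_def filterlim_at_bot)
  then obtain b :: ereal where b: "b > 0" "\<And>y. 0 < y \<Longrightarrow> y < b \<Longrightarrow> f y \<le> c"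
    by (auto simp: eventually_at_right[of 0 "1::ereal"])
  have "0 < min b (ereal M)" using b assms by auto
  then obtain a :: real where "0 < ereal a" "ereal a < min b (ereal M)"
    using ereal_dense2 by blast
  then show ?thesis using b by (intro that[of a]) auto
qed

lemma FK_mono: "f \<in> FK \<Longrightarrow> 0 < a \<Longrightarrow> a \<le> b \<Longrightarrow> f a \<le> f b"
  by (auto simp: FK_def mono_on_def)

lemma FK_continuous_real:
  assumes "f \<in> FK" "continuous_on S g" "\<And>t. t \<in> S \<Longrightarrow> 0 < g t"
  shows "continuous_on S (\<lambda>t. f (ereal (g t)))"
proof -
  have "continuous_on {0<..} f" using assms(1) by (simp add: FK_def)
  moreover have "continuous_on S (\<lambda>t. ereal (g t))"
    using assms(2) by (intro continuous_on_ereal)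
  ultimately show ?thesis
    by (rule continuous_on_compose2) (use assms(3) in auto)
qed

lemma star_prod_fin_exists:
  fixes N :: real
  assumes f1: "f1 \<in> FK" and f2: "f2 \<in> FK" and N: "0 < N"
  obtains t where "0 < t" "t < N" "f1 (ereal t) = f2 (ereal (N - t))"
proof -
  obtain a where a: "0 < a" "a < N/2" "f1 (ereal a) \<le> f2 (ereal (N/2))"
    using FK_small[OF f1, of "N/2"] N by (metis half_gt_zero)
  obtain b where b: "0 < b" "b < N/2" "f2 (ereal b) \<le> f1 (ereal (N/2))"
    using FK_small[OF f2, of "N/2"] N by (metis half_gt_zero)
  let ?h = "\<lambda>t. f1 (ereal t) - f2 (ereal (N - t))"
  have "f2 (ereal (N/2)) \<le> f2 (ereal (N - a))"
    using a N by (intro FK_mono[OF f2]) auto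
  then have h1: "?h a \<le> 0" using a by simp
  have "f1 (ereal (N/2)) \<le> f1 (ereal (N - b))"
    using b N by (intro FK_mono[OF f1]) auto
  then have h2: "0 \<le> ?h (N - b)" using b by simp
  have "continuous_on {a..N - b} ?h"
    using a b by (intro continuous_intros FK_continuous_real f1 f2) auto
  then obtain t where "a \<le> t" "t \<le> N - b" "?h t = 0"
    using IVT'[of ?h a 0 "N - b"] h1 h2 a b by auto
  then show ?thesis using a b by (intro that[of t]) auto
qed

lemma star_prod_fin_le:
  assumes f1: "f1 \<in> FK" and f2: "f2 \<in> FK"
    and "0 < N1" "0 < N2" "f1 N1 = f2 N2" "0 < M1" "0 < M2" "f1 M1 = f2 M2"
    and le: "N1 + N2 \<le> M1 + M2" and fin: "N1 + N2 < \<infinity>"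
  shows "f1 N1 \<le> f1 M1"
proof (cases "N1 \<le> M1")
  case True
  then show ?thesis using FK_mono[OF f1, of N1 M1] assms by simp
next
  case False
  then have "N2 \<le> M2" using le fin
    by (cases N1; cases N2; cases M1; cases M2) auto
  then show ?thesis using FK_mono[OF f2, of N2 M2] assms by simp
qed

lemma star_prod_fin_ex1:
  assumes "f1 \<in> FK" "f2 \<in> FK" "0 < N" "N \<noteq> \<infinity>"
  shows "\<exists>!v. \<exists>N1>0. \<exists>N2>0. N1 + N2 = N \<and> f1 N1 = v \<and> f2 N2 = v"
proof -
  obtain r where r: "N = ereal r" "0 < r" using assms by (cases N) auto
  obtain t where t: "0 < t" "t < r" "f1 (ereal t) = f2 (ereal (r - t))"
    using star_prod_fin_exists[OF assms(1,2) r(2)] by blast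
  show ?thesis
  proof (rule ex1I[of _ "f1 (ereal t)"])
    show "\<exists>N1>0. \<exists>N2>0. N1 + N2 = N \<and> f1 N1 = f1 (ereal t) \<and> f2 N2 = f1 (ereal t)"
      using t r by (intro exI[of _ "ereal t"] conjI exI[of _ "ereal (r - t)"]) auto
  next
    fix v assume "\<exists>N1>0. \<exists>N2>0. N1 + N2 = N \<and> f1 N1 = v \<and> f2 N2 = v"
    then obtain N1 N2 where n: "0 < N1" "0 < N2" "N1 + N2 = N" "f1 N1 = v" "f2 N2 = v"
      by blast
    have s: "ereal t + ereal (r - t) = N" using r by simp
    have "f1 N1 \<le> f1 (ereal t)"
      using star_prod_fin_le[OF assms(1,2), of N1 N2 "ereal t" "ereal (r - t)"] n t s r by auto
    moreover have "f1 (ereal t) \<le> f1 N1"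
      using star_prod_fin_le[OF assms(1,2), of "ereal t" "ereal (r - t)" N1 N2] n t s r by auto
    ultimately show "v = f1 (ereal t)" using n by simp
  qed
qed

lemma star_prod_fin_convergent:
  assumes f1: "f1 \<in> FK" and f2: "f2 \<in> FK"
  shows "\<exists>l. ((\<lambda>t::real. star_prod_fin f1 f2 (ereal t)) \<longlongrightarrow> l) at_top"
proof -
  let ?s = "\<lambda>t::real. star_prod_fin f1 f2 (ereal t)"
  have ex: "\<exists>N1>0. \<exists>N2>0. N1 + N2 = ereal t \<and> f1 N1 = ?s t \<and> f2 N2 = ?s t" if "0 < t" for t
    unfolding star_prod_fin_def by (rule theI') (use star_prod_fin_ex1[OF f1 f2] that in auto)
  have mono: "?s t \<le> ?s u" if tu: "0 < t" "t \<le> u" for t u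
  proof -
    obtain N1 N2 where n: "0 < N1" "0 < N2" "N1 + N2 = ereal t" "f1 N1 = ?s t" "f2 N2 = ?s t"
      using ex[OF tu(1)] by blast
    obtain M1 M2 where m: "0 < M1" "0 < M2" "M1 + M2 = ereal u" "f1 M1 = ?s u" "f2 M2 = ?s u"
      using ex[of u] tu by auto
    show ?thesis
      using star_prod_fin_le[OF f1 f2, of N1 N2 M1 M2] n m tu by auto
  qed
  have bound: "?s t \<le> f1 \<infinity>" if "0 < t" for t
    using ex[OF that] FK_mono[OF f1] by (metis ereal_less_eq(1))
  have bdd: "bdd_above (?s ` {0<..})"
    by (rule bdd_aboveI[of _ "f1 \<infinity>"]) (use bound in auto)
  have "(?s \<longlongrightarrow> (SUP t\<in>{0<..}. ?s t)) at_top"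
  proof (rule order_tendstoI)
    fix a assume "a < (SUP t\<in>{0<..}. ?s t)"
    then obtain t where t: "0 < t" "a < ?s t"
      using less_cSUP_iff[OF _ bdd] by auto
    show "eventually (\<lambda>u. a < ?s u) at_top"
      using eventually_ge_at_top[of t] by eventually_elim (use mono t in fastforce)
  next
    fix a assume a: "(SUP t\<in>{0<..}. ?s t) < a"
    show "eventually (\<lambda>u. ?s u < a) at_top"
      using eventually_gt_at_top[of 0]
    proof eventually_elim
      case (elim u)
      then have "?s u \<le> (SUP t\<in>{0<..}. ?s t)" by (intro cSUP_upper bdd) auto
      then show ?case using a by simp
    qed
  qed
  then show ?thesis by blast
qed

end

theory Submission imports Defs
begin

text \<open>
  For \<open>F\<close> on the product, \<open>\<Gamma>\<^sub>2(F)(x,y)\<close> is \<open>\<Gamma>\<^sub>2(F(\<cdot>,y))(x) + \<Gamma>\<^sub>2(F(x,\<cdot>))(y)\<close> plus half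
  the sum of the squares of the mixed second differences of \<open>F\<close>; these vanish when
  \<open>F(u,v) = f(u) + g(v)\<close>. With \<open>N = N1 + N2\<close>, the inequality \<open>(a+b)\<^sup>2/N \<le> a\<^sup>2/N1 + b\<^sup>2/N2\<close>
  yields the lower bound for the curvature of the product, and test functions scaled to
  \<open>\<Delta>f(x) = N1\<close>, \<open>\<Delta>g(y) = N2\<close>, the equality case, yield the upper bound. The value at \<open>\<infinity>\<close>
  follows by continuity, because as a function of \<open>1/N\<close> the curvature is an infimum of affine
  functions with uniformly bounded slopes \<open>-(\<Delta>f(x))\<^sup>2/\<Gamma>(f)(x)\<close>.
\<close>

section \<open>The curvature function at a vertex\<close>

lemma nbrs_verts: "simple_graph G \<Longrightarrow> y \<in> nbrs G x \<Longrightarrow> y \<in> verts G"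
  unfolding simple_graph_def nbrs_def by (fastforce simp: doubleton_eq_iff)

lemma not_in_nbrs_self: "simple_graph G \<Longrightarrow> x \<notin> nbrs G x"
  unfolding simple_graph_def nbrs_def by (fastforce simp: doubleton_eq_iff)

lemma Gam_eq: "Gam G f g x = (\<Sum>y\<in>nbrs G x. (f y - f x) * (g y - g x)) / 2"
  unfolding Gam_def laplacian_def
  by (simp add: sum_distrib_left sum_subtractf[symmetric] algebra_simps)

lemma Gam_nonneg: "0 \<le> Gam G f f x"
  unfolding Gam_eq by (simp add: sum_nonneg)

text \<open>Since \<Gamma> is symmetric, the two terms subtracted in \<Gamma>_2 coincide on the
  diagonal.\<close>

lemma Gam2_eq: "Gam2 G f f x = laplacian G (Gam G f f) x / 2 - Gam G f (laplacian G f) x"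
proof -
  have "Gam G (laplacian G f) f x = Gam G f (laplacian G f) x"
    by (simp add: Gam_eq mult.commute)
  then show ?thesis by (simp add: Gam2_def field_simps)
qed

lemma laplacian_scale: "laplacian G (\<lambda>z. c * f z) x = c * laplacian G f x"
  by (simp add: laplacian_def sum_distrib_left algebra_simps)

lemma Gam_scale: "Gam G (\<lambda>z. c * f z) (\<lambda>z. d * g z) x = c * d * Gam G f g x"
  by (simp add: Gam_eq sum_distrib_left algebra_simps)

lemma Gam2_scale: "Gam2 G (\<lambda>z. c * f z) (\<lambda>z. c * f z) x = c\<^sup>2 * Gam2 G f f x"
proof -
  have "Gam G (\<lambda>z. c * f z) (\<lambda>z. c * f z) = (\<lambda>z. (c * c) * Gam G f f z)"
    "laplacian G (\<lambda>z. c * f z) = (\<lambda>z. c * laplacian G f z)"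
    by (auto simp: Gam_scale laplacian_scale)
  then show ?thesis
    by (simp only: Gam2_eq laplacian_scale Gam_scale) (simp add: algebra_simps power2_eq_square)
qed

lemma laplacian_add_const: "laplacian G (\<lambda>z. f z + c) x = laplacian G f x"
  by (simp add: laplacian_def)

lemma Gam_add_const: "Gam G (\<lambda>z. f z + c) (\<lambda>z. g z + d) x = Gam G f g x"
  by (simp add: Gam_eq)

lemma Gam2_add_const: "Gam2 G (\<lambda>z. f z + c) (\<lambda>z. f z + c) x = Gam2 G f f x"
proof -
  have "Gam G (\<lambda>z. f z + c) (\<lambda>z. f z + c) = Gam G f f"
    "laplacian G (\<lambda>z. f z + c) = laplacian G f"
    by (auto simp: Gam_add_const laplacian_add_const)
  then show ?thesis
    using Gam_add_const[of G f c "laplacian G f" 0 x] by (simp add: Gam2_eq)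
qed

section \<open>Bounds by \<Gamma>(f)(x) from local finiteness\<close>

lemma laplacian_square_le:
  "(laplacian G f x)\<^sup>2 \<le> 2 * real (card (nbrs G x)) * Gam G f f x"
  using Cauchy_Schwarz_ineq_sum[of "\<lambda>_. 1" "\<lambda>y. f y - f x" "nbrs G x"]
  by (simp add: laplacian_def Gam_eq power2_eq_square)

text \<open>Completing the square in the second differences at each neighbour of \<open>x\<close>
  leaves only a multiple of \<Gamma>(f)(x). This makes the admissible set of \<open>K\<close>
  nonempty.\<close>

lemma Gam2_lower_bound:
  assumes "simple_graph G" "locally_finite G" "x \<in> verts G"
  obtains C where "\<And>f. - C * Gam G f f x \<le> Gam2 G f f x"
proof -
  let ?N = "nbrs G x"
  \<comment> \<open>Any common bound for the degrees of the neighbours would do; the sum avoids a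
    maximum over a possibly empty set.\<close>
  define D where "D = (\<Sum>y\<in>?N. real (card (nbrs G y)))"
  have fin: "finite ?N" using assms by (auto simp: locally_finite_def)
  have D: "real (card (nbrs G y)) \<le> D" if "y \<in> ?N" for y
    unfolding D_def using that fin by (intro member_le_sum) auto
  have "- ((D + real (card ?N)) / 2) * Gam G f f x \<le> Gam2 G f f x" for f
  proof -
    \<comment> \<open>The part of \<Gamma>_2(f)(x) attached to the neighbour \<open>y\<close>; what
      remains of \<Gamma>_2 consists of multiples of \<Gamma>(f)(x) and of the squared Laplacian at
      \<open>x\<close>.\<close>
    let ?p = "\<lambda>y. (\<Sum>z\<in>nbrs G y. (f z - f y) * (f z - f y)) / 4
                   - (f y - f x) * laplacian G f y / 2"
    have p: "- (D / 4) * ((f y - f x) * (f y - f x)) \<le> ?p y" if y: "y \<in> ?N" for y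
    proof -
      \<comment> \<open>One quarter of this expanded square is \<open>?p y\<close> plus
        \<open>card (nbrs G y) / 4\<close> times the squared increment from \<open>x\<close> to
        \<open>y\<close>.\<close>
      have "0 \<le> (\<Sum>z\<in>nbrs G y. ((f z - f y) - (f y - f x)) * ((f z - f y) - (f y - f x)))"
        by (simp add: sum_nonneg)
      also have "\<dots> = (\<Sum>z\<in>nbrs G y. (f z - f y) * (f z - f y) - 2 * ((f y - f x) * (f z - f y))
                         + (f y - f x) * (f y - f x))"
        by (intro sum.cong) (auto simp: algebra_simps)
      also have "\<dots> = (\<Sum>z\<in>nbrs G y. (f z - f y) * (f z - f y))
          - 2 * ((f y - f x) * laplacian G f y)
          + real (card (nbrs G y)) * ((f y - f x) * (f y - f x))"
        by (simp only: laplacian_def sum.distrib sum_subtractf sum_distrib_left[symmetric] sum_constant)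
        (simp add: algebra_simps)
      also have "real (card (nbrs G y)) * ((f y - f x) * (f y - f x))
          \<le> D * ((f y - f x) * (f y - f x))"
        by (intro mult_right_mono D y) simp
      finally show ?thesis by simp
    qed
    have "- (D / 2) * Gam G f f x = (\<Sum>y\<in>?N. - (D / 4) * ((f y - f x) * (f y - f x)))"
      by (simp add: Gam_eq sum_distrib_left sum_distrib_right sum_divide_distrib)
    also have "\<dots> \<le> (\<Sum>y\<in>?N. ?p y)" by (intro sum_mono p)
    also have "\<dots> = Gam2 G f f x + real (card ?N) / 2 * Gam G f f x - (laplacian G f x)\<^sup>2 / 2"
    proof -
      let ?S = "\<Sum>y\<in>?N. \<Sum>z\<in>nbrs G y. (f z - f y) * (f z - f y)"
      let ?T = "\<Sum>y\<in>?N. (f y - f x) * laplacian G f y"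
      have sum_p: "(\<Sum>y\<in>?N. ?p y) = ?S / 4 - ?T / 2"
        by (simp only: sum_subtractf sum_divide_distrib)
      have lapGam: "laplacian G (Gam G f f) x = ?S / 2 - real (card ?N) * Gam G f f x"
        by (simp only: laplacian_def sum_subtractf sum_constant) (simp only: Gam_eq sum_divide_distrib)
      have Gamlap: "Gam G f (laplacian G f) x = ?T / 2 - (laplacian G f x)\<^sup>2 / 2"
      proof -
        have "Gam G f (laplacian G f) x = (\<Sum>y\<in>?N. (f y - f x) * laplacian G f y
                - (f y - f x) * laplacian G f x) / 2"
          unfolding Gam_eq by (simp only: right_diff_distrib)
        also have "\<dots> = ((\<Sum>y\<in>?N. (f y - f x) * laplacian G f y)
                - (\<Sum>y\<in>?N. f y - f x) * laplacian G f x) / 2"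
          by (subst sum_subtractf) (simp only: sum_distrib_right)
        also have "(\<Sum>y\<in>?N. f y - f x) = laplacian G f x" by (simp only: laplacian_def)
        finally show ?thesis by (simp add: power2_eq_square diff_divide_distrib)
      qed
      have "S / 4 - T / 2 = (S / 2 - c * g) / 2 - (T / 2 - l / 2) + c / 2 * g - l / 2"
        for S T c g l :: real
        by (simp add: field_simps)
      then show ?thesis unfolding sum_p Gam2_eq lapGam Gamlap .
    qed
    also have "\<dots> \<le> Gam2 G f f x + real (card ?N) / 2 * Gam G f f x" by simp
    finally show ?thesis by (simp add: field_simps)
  qed
  then show ?thesis by (rule that)
qed

section \<open>Dependence of the curvature-dimension inequality on the dimension\<close>

lemma CD_ineq_shift:
  assumes "CD_ineq G x M K"
    and "real_of_ereal (1 / N) - real_of_ereal (1 / M) \<le> e" "0 \<le> e"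
  shows "CD_ineq G x N (K - 2 * real (card (nbrs G x)) * e)"
  unfolding CD_ineq_def
proof
  fix f
  let ?L = "(laplacian G f x)\<^sup>2" and ?d = "2 * real (card (nbrs G x))"
  have "(real_of_ereal (1 / N) - real_of_ereal (1 / M)) * ?L \<le> e * ?L"
    by (intro mult_right_mono assms) simp
  moreover have "e * ?L \<le> e * (?d * Gam G f f x)"
    by (intro mult_left_mono laplacian_square_le assms)
  moreover have "real_of_ereal (1 / M) * ?L + K * Gam G f f x \<le> Gam2 G f f x"
    using assms(1) by (auto simp: CD_ineq_def)
  ultimately show "real_of_ereal (1 / N) * ?L + (K - ?d * e) * Gam G f f x \<le> Gam2 G f f x"
    by (simp add: algebra_simps)
qed

lemma inverse_dim_ereal: "0 < r \<Longrightarrow> real_of_ereal (1 / ereal r) = 1 / r"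
  by (simp add: one_ereal_def)

lemma inverse_dim_nonneg: "0 < N \<Longrightarrow> 0 \<le> real_of_ereal (1 / N)"
  by (cases N) (auto simp: inverse_dim_ereal)

lemma inverse_dim_antimono: "0 < N \<Longrightarrow> N \<le> M \<Longrightarrow> real_of_ereal (1 / M) \<le> real_of_ereal (1 / N)"
  by (cases N; cases M) (auto simp: inverse_dim_ereal frac_le)

section \<open>Existence of the maximal constant and regularity in the dimension\<close>

locale positive_degree_vertex =
  fixes G :: "'a graph" and x :: 'a
  assumes simple: "simple_graph G" and loc_fin: "locally_finite G"
    and vert: "x \<in> verts G" and deg: "card (nbrs G x) \<ge> 1"
begin

text \<open>For infinite dimension the Laplacian term disappears and the lower bound on \<Gamma>_2
  suffices; \<open>CD_ineq_shift\<close> then passes to any \<open>N\<close>.\<close>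

lemma CD_ineq_nonempty:
  assumes "0 < N"
  shows "\<exists>K. CD_ineq G x N K"
proof -
  obtain C where "\<And>f. - C * Gam G f f x \<le> Gam2 G f f x"
    using Gam2_lower_bound[OF simple loc_fin vert] by blast
  then have "CD_ineq G x \<infinity> (- C)" by (auto simp: CD_ineq_def)
  then show ?thesis
    using CD_ineq_shift[of G x \<infinity> "- C" N "real_of_ereal (1 / N)"] inverse_dim_nonneg[OF assms]
    by auto
qed

text \<open>Tested on the indicator of \<open>x\<close>, for which \<Gamma> is positive. Keeping the
  term in \<open>1 / N\<close> explicit serves both the boundedness for fixed \<open>N\<close> and
  the limit at 0.\<close>

lemma CD_ineq_upper_bound:
  obtains B where
    "\<And>N K. CD_ineq G x N K \<Longrightarrow> K \<le> B - real_of_ereal (1 / N) * 2 * real (card (nbrs G x))"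
proof -
  let ?f = "\<lambda>z. if z = x then 1 else 0 :: real" and ?d = "real (card (nbrs G x))"
  have ne: "y \<in> nbrs G x \<Longrightarrow> y \<noteq> x" for y using not_in_nbrs_self[OF simple, of x] by auto
  have L: "laplacian G ?f x = - ?d"
  proof -
    have "laplacian G ?f x = (\<Sum>y\<in>nbrs G x. -1)"
      unfolding laplacian_def by (intro sum.cong) (use ne in auto)
    then show ?thesis by simp
  qed
  have g: "Gam G ?f ?f x = ?d / 2"
  proof -
    have "Gam G ?f ?f x = (\<Sum>y\<in>nbrs G x. 1) / 2"
      unfolding Gam_eq by (intro arg_cong[where f = "\<lambda>s. s / 2"] sum.cong) (use ne in auto)
    then show ?thesis by simp
  qed
  have "K \<le> 2 * Gam2 G ?f ?f x / ?d - real_of_ereal (1 / N) * 2 * ?d" if "CD_ineq G x N K" for N K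
  proof -
    have "real_of_ereal (1 / N) * (- ?d)\<^sup>2 + K * (?d / 2) \<le> Gam2 G ?f ?f x"
      using that unfolding CD_ineq_def L[symmetric] g[symmetric] by blast
    then show ?thesis using deg by (simp add: field_simps power2_eq_square)
  qed
  then show ?thesis by (rule that)
qed

text \<open>The admissible \<open>K\<close> form a set closed under suprema, because each test
  function imposes an affine inequality, and downward closed, because \<Gamma>(f) is nonnegative. So
  the maximum exists and determines the set.\<close>

lemma CD_ineq_iff_le_curvature:
  assumes "0 < N"
  shows "CD_ineq G x N K \<longleftrightarrow> K \<le> curvature G x N"
proof -
  define S where "S = {K. CD_ineq G x N K}"
  obtain B where "\<And>N K. CD_ineq G x N K \<Longrightarrow> K \<le> B - real_of_ereal (1 / N) * 2 * real (card (nbrs G x))"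
    using CD_ineq_upper_bound by blast
  then have bdd: "bdd_above S" by (auto simp: bdd_above_def S_def)
  have ne: "S \<noteq> {}" using CD_ineq_nonempty[OF assms] by (auto simp: S_def)
  have CD: "CD_ineq G x N (Sup S)"
    unfolding CD_ineq_def
  proof
    fix f
    let ?c = "real_of_ereal (1 / N) * (laplacian G f x)\<^sup>2"
    have le: "?c + K * Gam G f f x \<le> Gam2 G f f x" if "K \<in> S" for K
      using that by (auto simp: S_def CD_ineq_def)
    show "?c + Sup S * Gam G f f x \<le> Gam2 G f f x"
    \<comment> \<open>If \<Gamma>(f)(x) vanishes, \<open>K\<close> drops out and any element of
      \<open>S\<close> gives the claim; otherwise division bounds all of \<open>S\<close>.\<close>
    proof (cases "Gam G f f x = 0")
      case True
      then show ?thesis using le ne by auto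
    next
      case False
      then have pos: "0 < Gam G f f x" using Gam_nonneg[of G f x] by simp
      have "Sup S \<le> (Gam2 G f f x - ?c) / Gam G f f x"
        by (rule cSup_least[OF ne]) (use le pos in \<open>simp add: field_simps\<close>)
      then show ?thesis using pos by (simp add: field_simps)
    qed
  qed
  have eq: "curvature G x N = Sup S"
    unfolding curvature_def
    by (rule Greatest_equality[where P = "CD_ineq G x N", OF CD]) (auto simp: S_def intro!: cSup_upper bdd[unfolded S_def])
  show ?thesis
  proof
    assume "CD_ineq G x N K" then show "K \<le> curvature G x N"
      unfolding eq by (intro cSup_upper bdd) (simp add: S_def)
  next
    assume "K \<le> curvature G x N"
    then have "K * Gam G f f x \<le> Sup S * Gam G f f x" for f
      unfolding eq by (intro mult_right_mono Gam_nonneg)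
    then show "CD_ineq G x N K" using CD unfolding CD_ineq_def
      by (meson add_left_mono order_trans)
  qed
qed

text \<open>A one-sided Lipschitz estimate in the variable \<open>1 / N\<close>:
  \<open>e = 0\<close> gives monotonicity, and \<open>e\<close> equal to the distance of the
  reciprocals gives continuity.\<close>

lemma curvature_diff_le:
  assumes "0 < N" "0 < M" "real_of_ereal (1 / N) - real_of_ereal (1 / M) \<le> e" "0 \<le> e"
  shows "curvature G x M - 2 * real (card (nbrs G x)) * e \<le> curvature G x N"
  using CD_ineq_shift[of G x M "curvature G x M" N e] CD_ineq_iff_le_curvature assms by auto

lemma curvature_in_FK: "curvature G x \<in> FK"
proof -
  let ?d = "real (card (nbrs G x))" and ?q = "\<lambda>N. real_of_ereal (1 / N)"
  have "mono_on {0<..} (curvature G x)"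
    by (rule mono_onI)
      (use curvature_diff_le[where e = 0] inverse_dim_antimono in force)
  moreover have "continuous_on {0<..} (curvature G x)"
    unfolding continuous_on_def
  proof
    fix N :: ereal assume N: "N \<in> {0<..}"
    \<comment> \<open>The reciprocal is finite on all of (0,\<infinity>], with value 0 at
      \<infinity>, so its extended-real continuity carries over to the real-valued
      \<open>?q\<close>.\<close>
    have eq: "1 / N = ereal (?q N)" using N by (cases N) (auto simp: one_ereal_def)
    have "((\<lambda>M. 1 / M) \<longlongrightarrow> 1 / N) (at N within {0<..})"
      unfolding divide_ereal_def
      using N by (intro tendsto_mult_ereal tendsto_const
          Lim_at_imp_Lim_at_within[OF inverse_ereal_tendsto_pos]) (cases N; auto)+
    then have "((\<lambda>M. 1 / M) \<longlongrightarrow> ereal (?q N)) (at N within {0<..})"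
      by (subst eq[symmetric])
    then have "(?q \<longlongrightarrow> ?q N) (at N within {0<..})"
      by (rule lim_real_of_ereal)
    then have "((\<lambda>M. 2 * ?d * \<bar>?q M - ?q N\<bar>) \<longlongrightarrow> 2 * ?d * \<bar>?q N - ?q N\<bar>) (at N within {0<..})"
      by (intro tendsto_mult tendsto_const tendsto_rabs tendsto_diff)
    then have lim: "((\<lambda>M. 2 * ?d * \<bar>?q M - ?q N\<bar>) \<longlongrightarrow> 0) (at N within {0<..})" by simp
    have "\<bar>curvature G x M - curvature G x N\<bar> \<le> 2 * ?d * \<bar>?q M - ?q N\<bar>" if "0 < M" for M
    proof -
      have "curvature G x M - 2 * ?d * \<bar>?q M - ?q N\<bar> \<le> curvature G x N"
        "curvature G x N - 2 * ?d * \<bar>?q M - ?q N\<bar> \<le> curvature G x M"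
        using N that by (intro curvature_diff_le; simp)+
      then show ?thesis by linarith
    qed
    then have "\<forall>\<^sub>F M in at N within {0<..}.
        norm (curvature G x M - curvature G x N) \<le> 2 * ?d * \<bar>?q M - ?q N\<bar>"
      by (auto simp: eventually_at_filter)
    from Lim_null_comparison[OF this lim]
    show "(curvature G x \<longlongrightarrow> curvature G x N) (at N within {0<..})"
      by (simp add: LIM_zero_iff)
  qed
  moreover have "filterlim (curvature G x) at_bot (at_right 0)"
    unfolding filterlim_at_bot
  proof
    fix Z
    obtain B where B: "\<And>N K. CD_ineq G x N K \<Longrightarrow> K \<le> B - ?q N * 2 * ?d"
      using CD_ineq_upper_bound by blast
    \<comment> \<open>For \<open>N < 1 / t\<close> the reciprocal of \<open>N\<close> exceeds
      \<open>B - Z\<close>, and the degree is at least 1; the maximum with 1 keeps the threshold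
      \<open>1 / t\<close> positive.\<close>
    define t where "t = max 1 (B - Z)"
    have "0 < t" by (simp add: t_def)
    have "curvature G x N \<le> Z" if N: "0 < N" "N < ereal (1 / t)" for N
    proof -
      obtain r where r: "N = ereal r" "0 < r" "r < 1 / t" using N by (cases N) auto
      have "t \<le> 1 / r" using r \<open>0 < t\<close> by (simp add: field_simps)
      moreover have "1 / r * 1 \<le> 1 / r * (2 * ?d)" using r deg by (intro mult_left_mono) auto
      moreover have "curvature G x N \<le> B - 1 / r * (2 * ?d)"
        using B[of N "curvature G x N"] CD_ineq_iff_le_curvature[of N "curvature G x N"] r
        by (simp add: mult.assoc inverse_dim_ereal)
      ultimately show ?thesis by (simp add: t_def)
    qed
    moreover have "0 < ereal (1 / t)" using \<open>0 < t\<close> by simp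
    ultimately have "\<exists>b>0. \<forall>N>0. N < b \<longrightarrow> curvature G x N \<le> Z" by blast
    then show "\<forall>\<^sub>F N in at_right 0. curvature G x N \<le> Z"
      by (simp add: eventually_at_right[of 0 "1 :: ereal"])
  qed
  ultimately show ?thesis by (simp add: FK_def)
qed

end

section \<open>Cartesian products\<close>

lemma cart_prod_edge_iff:
  "{(x1, y1), (x2, y2)} \<in> edges (cart_prod G1 G2) \<longleftrightarrow>
     x1 \<in> verts G1 \<and> x2 \<in> verts G1 \<and> y1 \<in> verts G2 \<and> y2 \<in> verts G2 \<and>
     (x1 = x2 \<and> {y1, y2} \<in> edges G2 \<or> {x1, x2} \<in> edges G1 \<and> y1 = y2)"
  unfolding cart_prod_def by (auto simp: doubleton_eq_iff insert_commute)

lemma nbrs_cart_prod: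
  assumes "simple_graph G1" "simple_graph G2" "x \<in> verts G1" "y \<in> verts G2"
  shows "nbrs (cart_prod G1 G2) (x, y) = (\<lambda>a. (a, y)) ` nbrs G1 x \<union> (\<lambda>b. (x, b)) ` nbrs G2 y"
  using assms nbrs_verts[of G1 _ x] nbrs_verts[of G2 _ y]
  by (auto simp: nbrs_def cart_prod_edge_iff)

text \<open>The horizontal and vertical neighbours are disjoint because \<open>x\<close> is not its
  own neighbour.\<close>

lemma sum_nbrs_cart_prod:
  fixes h :: "'a \<times> 'b \<Rightarrow> real"
  assumes "simple_graph G1" "simple_graph G2" "locally_finite G1" "locally_finite G2"
    "x \<in> verts G1" "y \<in> verts G2"
  shows "(\<Sum>p\<in>nbrs (cart_prod G1 G2) (x, y). h p) =
    (\<Sum>a\<in>nbrs G1 x. h (a, y)) + (\<Sum>b\<in>nbrs G2 y. h (x, b))"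
proof -
  have fin: "finite (nbrs G1 x)" "finite (nbrs G2 y)" using assms by (auto simp: locally_finite_def)
  have "(\<lambda>a. (a, y)) ` nbrs G1 x \<inter> (\<lambda>b. (x, b)) ` nbrs G2 y = {}"
    using not_in_nbrs_self[OF assms(1), of x] by auto
  then show ?thesis
    unfolding nbrs_cart_prod[OF assms(1,2,5,6)]
    using fin by (simp add: sum.union_disjoint sum.reindex inj_on_def)
qed

lemma simple_graph_cart_prod:
  assumes "simple_graph G1" "simple_graph G2"
  shows "simple_graph (cart_prod G1 G2)"
proof -
  \<comment> \<open>Without loops in the factors, the two ends of a product edge differ in the
    moving coordinate.\<close>
  have "{u} \<notin> edges G1" "{v} \<notin> edges G2" for u v
    using not_in_nbrs_self[OF assms(1), of u] not_in_nbrs_self[OF assms(2), of v]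
    by (auto simp: nbrs_def)
  then show ?thesis
    by (auto simp: simple_graph_def cart_prod_def) (metis insert_absorb2)+
qed

lemma locally_finite_cart_prod:
  assumes "simple_graph G1" "simple_graph G2" "locally_finite G1" "locally_finite G2"
  shows "locally_finite (cart_prod G1 G2)"
  unfolding locally_finite_def
proof
  fix p assume "p \<in> verts (cart_prod G1 G2)"
  then obtain u v where "p = (u, v)" "u \<in> verts G1" "v \<in> verts G2"
    by (auto simp: cart_prod_def)
  then show "finite (nbrs (cart_prod G1 G2) p)"
    using assms by (auto simp: nbrs_cart_prod locally_finite_def)
qed

section \<open>Operators and curvature inequality on the product\<close>

context
  fixes G1 :: "'a graph" and G2 :: "'b graph"
  assumes simple1: "simple_graph G1" and simple2: "simple_graph G2"
    and fin1: "locally_finite G1" and fin2: "locally_finite G2"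
begin

lemmas sum_nbrs_prod = sum_nbrs_cart_prod[OF simple1 simple2 fin1 fin2]

lemma laplacian_cart_prod:
  assumes "x \<in> verts G1" "y \<in> verts G2"
  shows "laplacian (cart_prod G1 G2) F (x, y) =
    laplacian G1 (\<lambda>a. F (a, y)) x + laplacian G2 (\<lambda>b. F (x, b)) y"
  using assms by (simp add: laplacian_def sum_nbrs_prod)

lemma Gam_cart_prod:
  assumes "x \<in> verts G1" "y \<in> verts G2"
  shows "Gam (cart_prod G1 G2) F H (x, y) =
    Gam G1 (\<lambda>a. F (a, y)) (\<lambda>a. H (a, y)) x + Gam G2 (\<lambda>b. F (x, b)) (\<lambda>b. H (x, b)) y"
  using assms by (simp add: Gam_eq sum_nbrs_prod add_divide_distrib)

text \<open>All cross terms combine over the squares spanned by an edge at \<open>x\<close> and an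
  edge at \<open>y\<close>, and on each square they reduce to half of one perfect square.\<close>

lemma Gam2_cart_prod:
  assumes x: "x \<in> verts G1" and y: "y \<in> verts G2"
  shows "Gam2 (cart_prod G1 G2) F F (x, y) =
    Gam2 G1 (\<lambda>a. F (a, y)) (\<lambda>a. F (a, y)) x + Gam2 G2 (\<lambda>b. F (x, b)) (\<lambda>b. F (x, b)) y
    + (\<Sum>a\<in>nbrs G1 x. \<Sum>b\<in>nbrs G2 y. (F (a, b) - F (a, y) - F (x, b) + F (x, y))\<^sup>2) / 2"
proof -
  let ?P = "cart_prod G1 G2" and ?A = "nbrs G1 x" and ?B = "nbrs G2 y"
  let ?f = "\<lambda>a. F (a, y)" and ?g = "\<lambda>b. F (x, b)"
  let ?p = "\<lambda>a. F (a, y) - F (x, y)" and ?q = "\<lambda>b. F (x, b) - F (x, y)"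
  let ?u = "\<lambda>a b. F (a, b) - F (a, y)" and ?v = "\<lambda>a b. F (a, b) - F (x, b)"
  have vA: "a \<in> verts G1" if "a \<in> ?A" for a using nbrs_verts[OF simple1 that] .
  have vB: "b \<in> verts G2" if "b \<in> ?B" for b using nbrs_verts[OF simple2 that] .
  \<comment> \<open>Moving from \<open>x\<close> to \<open>a\<close> also changes the fibre on which
    the \<Gamma> of the other factor is taken, so its increments \<open>?q b\<close> become
    \<open>?u a b\<close>; symmetrically for \<open>?p\<close> and \<open>?v\<close>.\<close>
  have lapGam: "laplacian ?P (Gam ?P F F) (x, y) =
      laplacian G1 (Gam G1 ?f ?f) x + laplacian G2 (Gam G2 ?g ?g) y
      + (\<Sum>a\<in>?A. \<Sum>b\<in>?B. (?u a b)\<^sup>2 - (?q b)\<^sup>2) / 2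
      + (\<Sum>a\<in>?A. \<Sum>b\<in>?B. (?v a b)\<^sup>2 - (?p a)\<^sup>2) / 2"
  proof -
    have "laplacian ?P (Gam ?P F F) (x, y) =
      (\<Sum>a\<in>?A. (Gam G1 ?f ?f a - Gam G1 ?f ?f x) + (\<Sum>b\<in>?B. (?u a b)\<^sup>2 - (?q b)\<^sup>2) / 2)
      + (\<Sum>b\<in>?B. (Gam G2 ?g ?g b - Gam G2 ?g ?g y) + (\<Sum>a\<in>?A. (?v a b)\<^sup>2 - (?p a)\<^sup>2) / 2)"
      unfolding laplacian_def sum_nbrs_prod[OF x y]
      by (intro arg_cong2[where f = "(+)"] sum.cong refl)
        (auto simp: Gam_cart_prod x y vA vB Gam_eq[of G2 "\<lambda>b. F (_, b)" _ y]
          Gam_eq[of G1 "\<lambda>a. F (a, _)" _ x] sum_subtractf power2_eq_square diff_divide_distrib)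
    also have "\<dots> = laplacian G1 (Gam G1 ?f ?f) x + (\<Sum>a\<in>?A. \<Sum>b\<in>?B. (?u a b)\<^sup>2 - (?q b)\<^sup>2) / 2
      + (laplacian G2 (Gam G2 ?g ?g) y + (\<Sum>b\<in>?B. \<Sum>a\<in>?A. (?v a b)\<^sup>2 - (?p a)\<^sup>2) / 2)"
      by (simp only: sum.distrib sum_divide_distrib laplacian_def)
    also have "(\<Sum>b\<in>?B. \<Sum>a\<in>?A. (?v a b)\<^sup>2 - (?p a)\<^sup>2) = (\<Sum>a\<in>?A. \<Sum>b\<in>?B. (?v a b)\<^sup>2 - (?p a)\<^sup>2)"
      by (rule sum.swap)
    finally show ?thesis by simp
  qed
  have Gamlap: "Gam ?P F (laplacian ?P F) (x, y) =
      Gam G1 ?f (laplacian G1 ?f) x + Gam G2 ?g (laplacian G2 ?g) y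
      + (\<Sum>a\<in>?A. \<Sum>b\<in>?B. ?p a * (?u a b - ?q b)) / 2
      + (\<Sum>a\<in>?A. \<Sum>b\<in>?B. ?q b * (?v a b - ?p a)) / 2"
  proof -
    have 1: "?p a * (laplacian ?P F (a, y) - laplacian ?P F (x, y)) =
        ?p a * (laplacian G1 ?f a - laplacian G1 ?f x) + (\<Sum>b\<in>?B. ?p a * (?u a b - ?q b))"
      if "a \<in> ?A" for a
    proof -
      have "laplacian ?P F (a, y) - laplacian ?P F (x, y) =
          laplacian G1 ?f a - laplacian G1 ?f x + (\<Sum>b\<in>?B. ?u a b - ?q b)"
        using that by (simp only: laplacian_cart_prod x y vA laplacian_def[of G2] sum_subtractf)
      then show ?thesis by (simp only: distrib_left sum_distrib_left)
    qed
    have 2: "?q b * (laplacian ?P F (x, b) - laplacian ?P F (x, y)) =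
        ?q b * (laplacian G2 ?g b - laplacian G2 ?g y) + (\<Sum>a\<in>?A. ?q b * (?v a b - ?p a))"
      if "b \<in> ?B" for b
    proof -
      have "laplacian ?P F (x, b) - laplacian ?P F (x, y) =
          laplacian G2 ?g b - laplacian G2 ?g y + (\<Sum>a\<in>?A. ?v a b - ?p a)"
        using that by (simp only: laplacian_cart_prod x y vB laplacian_def[of G1] sum_subtractf)
      then show ?thesis by (simp only: distrib_left sum_distrib_left)
    qed
    have "Gam ?P F (laplacian ?P F) (x, y) =
        ((\<Sum>a\<in>?A. ?p a * (laplacian G1 ?f a - laplacian G1 ?f x) + (\<Sum>b\<in>?B. ?p a * (?u a b - ?q b)))
        + (\<Sum>b\<in>?B. ?q b * (laplacian G2 ?g b - laplacian G2 ?g y)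
             + (\<Sum>a\<in>?A. ?q b * (?v a b - ?p a)))) / 2"
      unfolding Gam_eq[of ?P] sum_nbrs_prod[OF x y]
      by (intro arg_cong2[where f = "(+)"] arg_cong2[where f = "(/)"] sum.cong refl 1 2)
    also have "\<dots> = Gam G1 ?f (laplacian G1 ?f) x + (\<Sum>a\<in>?A. \<Sum>b\<in>?B. ?p a * (?u a b - ?q b)) / 2
       + (Gam G2 ?g (laplacian G2 ?g) y + (\<Sum>b\<in>?B. \<Sum>a\<in>?A. ?q b * (?v a b - ?p a)) / 2)"
      by (simp only: sum.distrib add_divide_distrib Gam_eq)
    also have "(\<Sum>b\<in>?B. \<Sum>a\<in>?A. ?q b * (?v a b - ?p a)) = (\<Sum>a\<in>?A. \<Sum>b\<in>?B. ?q b * (?v a b - ?p a))"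
      by (rule sum.swap)
    finally show ?thesis by simp
  qed
  let ?S = "\<lambda>h :: 'a \<Rightarrow> 'b \<Rightarrow> real. \<Sum>a\<in>?A. \<Sum>b\<in>?B. h a b"
  have sums: "?S s / 4 + ?S t / 4 - ?S v / 2 - ?S w / 2 =
    ?S (\<lambda>a b. s a b / 4 + t a b / 4 - v a b / 2 - w a b / 2)" for s t v w
    by (simp only: sum.distrib sum_subtractf sum_divide_distrib)
  have "(\<Sum>a\<in>?A. \<Sum>b\<in>?B. (?u a b)\<^sup>2 - (?q b)\<^sup>2) / 4 + (\<Sum>a\<in>?A. \<Sum>b\<in>?B. (?v a b)\<^sup>2 - (?p a)\<^sup>2) / 4
      - (\<Sum>a\<in>?A. \<Sum>b\<in>?B. ?p a * (?u a b - ?q b)) / 2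
      - (\<Sum>a\<in>?A. \<Sum>b\<in>?B. ?q b * (?v a b - ?p a)) / 2
    = (\<Sum>a\<in>?A. \<Sum>b\<in>?B. ((?u a b)\<^sup>2 - (?q b)\<^sup>2) / 4 + ((?v a b)\<^sup>2 - (?p a)\<^sup>2) / 4
        - ?p a * (?u a b - ?q b) / 2 - ?q b * (?v a b - ?p a) / 2)"
    by (rule sums)
  \<comment> \<open>Both \<open>?u a b - ?q b\<close> and \<open>?v a b - ?p a\<close> equal the
    mixed difference w. The first two terms add up to w(w + p + q)/2, and the last two remove w(p +
    q)/2.\<close>
  also have "\<dots> = (\<Sum>a\<in>?A. \<Sum>b\<in>?B. (F (a, b) - F (a, y) - F (x, b) + F (x, y))\<^sup>2 / 2)"
    by (intro sum.cong refl) (simp add: field_simps power2_eq_square)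
  also have "\<dots> = (\<Sum>a\<in>?A. \<Sum>b\<in>?B. (F (a, b) - F (a, y) - F (x, b) + F (x, y))\<^sup>2) / 2"
    by (simp only: sum_divide_distrib)
  finally have sum_eq: "?S (\<lambda>a b. (?u a b)\<^sup>2 - (?q b)\<^sup>2) / 4 + ?S (\<lambda>a b. (?v a b)\<^sup>2 - (?p a)\<^sup>2) / 4
      - ?S (\<lambda>a b. ?p a * (?u a b - ?q b)) / 2 - ?S (\<lambda>a b. ?q b * (?v a b - ?p a)) / 2
    = ?S (\<lambda>a b. (F (a, b) - F (a, y) - F (x, b) + F (x, y))\<^sup>2) / 2" .
  \<comment> \<open>Stated over plain reals so that the large sums enter only by
    instantiation.\<close>
  have "(l1 + l2 + s / 2 + t / 2) / 2 - (g1 + g2 + v / 2 + w / 2) =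
      l1 / 2 - g1 + (l2 / 2 - g2) + e / 2"
    if "s / 4 + t / 4 - v / 2 - w / 2 = e / 2" for l1 l2 g1 g2 s t v w e :: real
    using that by (simp add: field_simps)
  from this[OF sum_eq] show ?thesis
    unfolding Gam2_eq lapGam Gamlap .
qed

text \<open>Only the two sections of \<open>F\<close> through the point enter, apart from the mixed
  squares; these are nonnegative and vanish for separated functions, so separated functions are the
  worst case.\<close>

lemma CD_ineq_cart_prod_iff:
  assumes "x \<in> verts G1" and "y \<in> verts G2"
  shows "CD_ineq (cart_prod G1 G2) (x, y) N K \<longleftrightarrow>
    (\<forall>f g. real_of_ereal (1 / N) * (laplacian G1 f x + laplacian G2 g y)\<^sup>2
            + K * (Gam G1 f f x + Gam G2 g g y) \<le> Gam2 G1 f f x + Gam2 G2 g g y)"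
    (is "?L \<longleftrightarrow> ?R")
proof
  assume L: ?L
  show ?R
  proof (intro allI)
    fix f :: "'a \<Rightarrow> real" and g :: "'b \<Rightarrow> real"
    have "(\<lambda>b. f x + g b) = (\<lambda>b. g b + f x)" by (simp add: add.commute)
    with L[unfolded CD_ineq_def, rule_format, of "\<lambda>(a, b). f a + g b"]
    show "real_of_ereal (1 / N) * (laplacian G1 f x + laplacian G2 g y)\<^sup>2
            + K * (Gam G1 f f x + Gam G2 g g y) \<le> Gam2 G1 f f x + Gam2 G2 g g y"
      using assms by (simp add: laplacian_cart_prod Gam_cart_prod Gam2_cart_prod
          laplacian_add_const Gam_add_const Gam2_add_const)
  qed
next
  assume R: ?R
  show ?L
    unfolding CD_ineq_def
  proof
    fix F :: "'a \<times> 'b \<Rightarrow> real"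
    have "0 \<le> (\<Sum>a\<in>nbrs G1 x. \<Sum>b\<in>nbrs G2 y. (F (a, b) - F (a, y) - F (x, b) + F (x, y))\<^sup>2) / 2"
      by (simp add: sum_nonneg)
    with R[rule_format, of "\<lambda>a. F (a, y)" "\<lambda>b. F (x, b)"]
    show "real_of_ereal (1 / N) * (laplacian (cart_prod G1 G2) F (x, y))\<^sup>2
        + K * Gam (cart_prod G1 G2) F F (x, y) \<le> Gam2 (cart_prod G1 G2) F F (x, y)"
      unfolding laplacian_cart_prod[OF assms] Gam_cart_prod[OF assms] Gam2_cart_prod[OF assms]
      by linarith
  qed
qed

end

section \<open>The star product formula\<close>

lemma sum_square_div_le:
  fixes a b m n :: real
  assumes "0 < m" "0 < n"
  shows "(a + b)\<^sup>2 / (m + n) \<le> a\<^sup>2 / m + b\<^sup>2 / n"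
proof -
  have "a\<^sup>2 / m + b\<^sup>2 / n - (a + b)\<^sup>2 / (m + n) = (a * n - b * m)\<^sup>2 / (m * n * (m + n))"
    using assms by (simp add: divide_simps) (simp add: algebra_simps power2_eq_square)
  also have "\<dots> \<ge> 0" using assms by simp
  finally show ?thesis by simp
qed

lemma const_zero_simps:
  "laplacian G (\<lambda>_. 0) x = 0" "Gam G (\<lambda>_. 0) (\<lambda>_. 0) x = 0" "Gam2 G (\<lambda>_. 0) (\<lambda>_. 0) x = 0"
  using Gam2_scale[of G 0 "\<lambda>_. 0" x] by (simp_all add: laplacian_def Gam_eq)

text \<open>Both sides of the inequality are quadratic in \<open>f\<close>, so a violating function
  with nonzero Laplacian at \<open>x\<close> can be rescaled to any prescribed nonzero value
  \<open>c\<close>; a vanishing Laplacian is the one obstruction.\<close>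

lemma not_CD_ineqE:
  assumes "\<not> CD_ineq G x N K" "c \<noteq> 0"
  obtains (zero) f where "laplacian G f x = 0" "Gam2 G f f x < K * Gam G f f x"
  | (scaled) f where "laplacian G f x = c"
      "Gam2 G f f x < real_of_ereal (1 / N) * c\<^sup>2 + K * Gam G f f x"
proof -
  obtain f where f: "Gam2 G f f x < real_of_ereal (1 / N) * (laplacian G f x)\<^sup>2 + K * Gam G f f x"
    using assms by (auto simp: CD_ineq_def not_le)
  show ?thesis
  proof (cases "laplacian G f x = 0")
    case True
    then show ?thesis using f zero by simp
  next
    case False
    define s where "s = c / laplacian G f x"
    have s: "s * laplacian G f x = c" "s \<noteq> 0" using False assms(2) by (auto simp: s_def)
    have "s\<^sup>2 * Gam2 G f f x
        < s\<^sup>2 * (real_of_ereal (1 / N) * (laplacian G f x)\<^sup>2 + K * Gam G f f x)"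
      using f s by (intro mult_strict_left_mono) auto
    also have "\<dots> = real_of_ereal (1 / N) * (s * laplacian G f x)\<^sup>2 + K * (s * s * Gam G f f x)"
      by (simp add: algebra_simps power2_eq_square)
    finally show ?thesis
      using s by (intro scaled[of "\<lambda>z. s * f z"]) (simp_all add: laplacian_scale Gam_scale Gam2_scale)
  qed
qed

lemma curvature_cart_prod_eqI:
  fixes n1 n2 v :: real
  assumes "positive_degree_vertex G1 x" "positive_degree_vertex G2 y"
    and pos: "0 < n1" "0 < n2"
    and v: "curvature G1 x (ereal n1) = v" "curvature G2 y (ereal n2) = v"
  shows "curvature (cart_prod G1 G2) (x, y) (ereal (n1 + n2)) = v"
proof -
  interpret a: positive_degree_vertex G1 x by fact
  interpret b: positive_degree_vertex G2 y by fact
  note iff = CD_ineq_cart_prod_iff[OF a.simple b.simple a.loc_fin b.loc_fin a.vert b.vert]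
  note q = inverse_dim_ereal
  have q12: "real_of_ereal (1 / ereal (n1 + n2)) = 1 / (n1 + n2)" using pos by (simp add: q)
  show ?thesis
    unfolding curvature_def
  proof (rule Greatest_equality)
    have CD: "CD_ineq G1 x (ereal n1) v" "CD_ineq G2 y (ereal n2) v"
      using a.CD_ineq_iff_le_curvature[of "ereal n1" v] b.CD_ineq_iff_le_curvature[of "ereal n2" v]
        v pos by auto
    show "CD_ineq (cart_prod G1 G2) (x, y) (ereal (n1 + n2)) v"
      unfolding iff q12
    proof (intro allI)
      fix f :: "'a \<Rightarrow> real" and g :: "'b \<Rightarrow> real"
      have "1 / n1 * (laplacian G1 f x)\<^sup>2 + v * Gam G1 f f x \<le> Gam2 G1 f f x"
        "1 / n2 * (laplacian G2 g y)\<^sup>2 + v * Gam G2 g g y \<le> Gam2 G2 g g y"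
        using CD unfolding CD_ineq_def q[OF pos(1)] q[OF pos(2)] by blast+
      then show "1 / (n1 + n2) * (laplacian G1 f x + laplacian G2 g y)\<^sup>2
          + v * (Gam G1 f f x + Gam G2 g g y) \<le> Gam2 G1 f f x + Gam2 G2 g g y"
        using sum_square_div_le[OF pos, of "laplacian G1 f x" "laplacian G2 g y"]
        by (simp add: algebra_simps)
    qed
  next
    fix K assume K: "CD_ineq (cart_prod G1 G2) (x, y) (ereal (n1 + n2)) K"
    have le: "1 / (n1 + n2) * (laplacian G1 f x + laplacian G2 g y)\<^sup>2
          + K * (Gam G1 f f x + Gam G2 g g y) \<le> Gam2 G1 f f x + Gam2 G2 g g y" for f g
      using K unfolding iff q12 by blast
    show "K \<le> v"
    proof (rule ccontr)
      assume "\<not> K \<le> v"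
      \<comment> \<open>Since \<open>v\<close> is the curvature of each factor at its own dimension,
        a larger \<open>K\<close> fails in both factors at once.\<close>
      then have nCD: "\<not> CD_ineq G1 x (ereal n1) K" "\<not> CD_ineq G2 y (ereal n2) K"
        using a.CD_ineq_iff_le_curvature[of "ereal n1" K] b.CD_ineq_iff_le_curvature[of "ereal n2" K]
          v pos by auto
      have "n1 \<noteq> 0" "n2 \<noteq> 0" using pos by auto
      show False
        using nCD(1) \<open>n1 \<noteq> 0\<close>
      proof (cases rule: not_CD_ineqE)
        case (zero f)
        \<comment> \<open>Extended by zero in the other factor, \<open>f\<close> keeps total
          Laplacian 0 and violates the product inequality whatever the dimension.\<close>
        then show False using le[of f "\<lambda>_. 0"] by (simp add: const_zero_simps)
      next
        case f: (scaled f)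
        show False
          using nCD(2) \<open>n2 \<noteq> 0\<close>
        proof (cases rule: not_CD_ineqE)
          case (zero g)
          then show False using le[of "\<lambda>_. 0" g] by (simp add: const_zero_simps)
        next
          case g: (scaled g)
          \<comment> \<open>With Laplacians \<open>n1\<close> and \<open>n2\<close> the dimension
            terms of the factors add up exactly to that of the product, so the two strict violations
            sum to one for the product.\<close>
          have "1 / n1 * n1\<^sup>2 + 1 / n2 * n2\<^sup>2 = 1 / (n1 + n2) * (n1 + n2)\<^sup>2"
            using pos by (simp add: power2_eq_square)
          then show False using le[of f g] f g unfolding q[OF pos(1)] q[OF pos(2)]
            by (simp add: algebra_simps)
        qed
      qed
    qed
  qed
qed

text \<open>Makes the continuity of curvature functions, in particular at \<infinity>, available for
  the product.\<close>

lemma positive_degree_vertex_cart_prod: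
  assumes "positive_degree_vertex G1 x" "positive_degree_vertex G2 y"
  shows "positive_degree_vertex (cart_prod G1 G2) (x, y)"
proof -
  interpret a: positive_degree_vertex G1 x by fact
  interpret b: positive_degree_vertex G2 y by fact
  have "nbrs G1 x \<noteq> {}" using a.deg by auto
  then have "nbrs (cart_prod G1 G2) (x, y) \<noteq> {}"
    using a.simple b.simple a.vert b.vert by (simp add: nbrs_cart_prod)
  moreover have lf: "locally_finite (cart_prod G1 G2)"
    using a.simple b.simple a.loc_fin b.loc_fin by (rule locally_finite_cart_prod)
  moreover have v: "(x, y) \<in> verts (cart_prod G1 G2)"
    using a.vert b.vert by (simp add: cart_prod_def)
  ultimately have "0 < card (nbrs (cart_prod G1 G2) (x, y))"
    unfolding locally_finite_def by (simp add: card_gt_0_iff)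
  with lf v show ?thesis
    using simple_graph_cart_prod[OF a.simple b.simple] by unfold_locales auto
qed

theorem theorem7p9:
  fixes G1 :: "'a graph" and G2 :: "'b graph" and x :: 'a and y :: 'b
  assumes "simple_graph G1" and "locally_finite G1"
    and "simple_graph G2" and "locally_finite G2"
    and "x \<in> verts G1" and "card (nbrs G1 x) \<ge> 1"
    and "y \<in> verts G2" and "card (nbrs G2 y) \<ge> 1"
  shows "\<forall>N::ereal. 0 < N \<longrightarrow>
    curvature (cart_prod G1 G2) (x, y) N = star_prod (curvature G1 x) (curvature G2 y) N"
proof (intro allI impI)
  fix N :: ereal assume N: "0 < N"
  let ?K1 = "curvature G1 x" and ?K2 = "curvature G2 y"
  let ?K = "curvature (cart_prod G1 G2) (x, y)"
  have v1: "positive_degree_vertex G1 x" and v2: "positive_degree_vertex G2 y"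
    using assms by unfold_locales auto
  note FK = positive_degree_vertex.curvature_in_FK
  have fin: "star_prod_fin ?K1 ?K2 (ereal t) = ?K (ereal t)" if t: "0 < t" for t
  proof -
    \<comment> \<open>Unique existence turns the definite description back into an actual splitting
      of \<open>t\<close>, to which the formula for fixed \<open>n1\<close>, \<open>n2\<close>
      applies.\<close>
    have "\<exists>N1>0. \<exists>N2>0. N1 + N2 = ereal t \<and> ?K1 N1 = star_prod_fin ?K1 ?K2 (ereal t)
        \<and> ?K2 N2 = star_prod_fin ?K1 ?K2 (ereal t)"
      unfolding star_prod_fin_def
      by (rule theI') (use star_prod_fin_ex1[OF FK[OF v1] FK[OF v2]] t in auto)
    then obtain N1 N2 where n: "0 < N1" "0 < N2" "N1 + N2 = ereal t"
      "?K1 N1 = star_prod_fin ?K1 ?K2 (ereal t)" "?K2 N2 = star_prod_fin ?K1 ?K2 (ereal t)"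
      by blast
    obtain n1 n2 where "N1 = ereal n1" "N2 = ereal n2" using n by (cases N1; cases N2) auto
    then show ?thesis
      using curvature_cart_prod_eqI[OF v1 v2, of n1 n2] n by auto
  qed
  show "?K N = star_prod ?K1 ?K2 N"
  proof (cases "N = \<infinity>")
    case False
    then show ?thesis using N fin by (cases N) (auto simp: star_prod_def)
  next
    case True
    have "continuous_on {0<..} ?K"
      using FK[OF positive_degree_vertex_cart_prod[OF v1 v2]] by (simp add: FK_def)
    then have "(?K \<longlongrightarrow> ?K \<infinity>) (at \<infinity> within {0<..})"
      by (simp add: continuous_on_def)
    \<comment> \<open>Real \<open>t\<close> tending to infinity approaches \<infinity> inside
      (0,\<infinity>] without reaching it, so continuity there yields the limit defining the star
      product.\<close>
    moreover have "filterlim ereal (at \<infinity> within {0<..}) at_top"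
      unfolding filterlim_at
      by (auto simp: tendsto_PInfty intro: eventually_gt_at_top)
    ultimately have "((\<lambda>t. ?K (ereal t)) \<longlongrightarrow> ?K \<infinity>) at_top"
      by (rule filterlim_compose)
    moreover have "\<forall>\<^sub>F t in at_top. ?K (ereal t) = star_prod_fin ?K1 ?K2 (ereal t)"
      using eventually_gt_at_top[of 0] by eventually_elim (simp add: fin)
    ultimately have "((\<lambda>t. star_prod_fin ?K1 ?K2 (ereal t)) \<longlongrightarrow> ?K \<infinity>) at_top"
      by (rule Lim_transform_eventually)
    then show ?thesis
      by (simp add: True star_prod_def tendsto_Lim)
  qed
qed

end
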